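(* (Brézis-Lieb Lemma) Let $\Omega\subset\mathbb R^N$, $N\ge2$, be a bounded domain with Lipschitz boundary, and let $\mathcal N$ be a generalized strong $\Phi$-function on $\Omega$ with the property that for every $\varepsilon>0$ there exists $C_\varepsilon>0$ such that $$\big|\mathcal N(x,|t+m|)-\mathcal N(x,|t|)\big|\le C_\varepsilon\,\mathcal N(x,|m|)+\varepsilon\,\mathcal N(x,|t|)$$ for every $t,m\ge0$ and for a.a. $x\in\Omega$. If $f_n\to f$ a.e. in $\Omega$ and $f_n\rightharpoonup f$ weakly in $L^{\mathcal N}(\Omega)$, then for every $\phi\in L^\infty(\Omega)$ $$\lim_{n\to\infty}\left(\int_\Omega\mathcal N(x,|f_n|)\phi\,dx-\int_\Omega\mathcal N(x,|f-f_n|)\phi\,dx\right)=\int_\Omega\mathcal N(x,|f|)\phi\,dx .$$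
   Context: A generalized strong $\Phi$-function on $\Omega$ is a function $\varphi:\Omega\times[0,\infty)\to[0,\infty]$, measurable in the first variable and, for a.a. $x\in\Omega$: increasing, convex and continuous (in the topology of $[0,\infty]$) in the second variable, with $\varphi(x,0)=0$, $\lim_{t\to0^+}\varphi(x,t)=0$, $\lim_{t\to\infty}\varphi(x,t)=\infty$. $L^\varphi(\Omega)$ is the Banach space of measurable $u$ with $\varrho_\varphi(\lambda u)=\int_\Omega\varphi(x,\lambda|u|)\,dx<\infty$ for some $\lambda>0$, with the Luxemburg norm $\|u\|_\varphi=\inf\{\lambda>0:\varrho_\varphi(u/\lambda)\le1\}$. *)

theory Defs
  imports "HOL-Analysis.Analysis"
begin

text \<open>A \<open>\<Phi>\<close>-function \<open>\<phi> : \<Omega> \<times> [0,\<infinity>) \<rightarrow> [0,\<infinity>]\<close> is a curried function into \<^typ>\<open>ennreal\<close> (whose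
  topology is that of \<open>[0,\<infinity>]\<close>), constrained only at arguments \<open>t \<ge> 0\<close> and \<open>x \<in> space M\<close>; the set
  \<open>\<Omega>\<close> is represented by the measure space \<open>M = lebesgue_on \<Omega>\<close>.  Convexity is spelled out because
  \<^const>\<open>convex_on\<close> is restricted to real-valued functions; it uses \<open>0 * \<infinity> = 0\<close>.\<close>

definition gen_strong_Phi :: "'a measure \<Rightarrow> ('a \<Rightarrow> real \<Rightarrow> ennreal) \<Rightarrow> bool" where
  "gen_strong_Phi M \<phi> \<longleftrightarrow>
     (\<forall>t\<ge>0. (\<lambda>x. \<phi> x t) \<in> borel_measurable M) \<and>
     (AE x in M.
        mono_on {0..} (\<phi> x) \<and>
        (\<forall>s\<ge>0. \<forall>t\<ge>0. \<forall>u\<ge>0. \<forall>v\<ge>0. u + v = 1 \<longrightarrow>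
           \<phi> x (u * s + v * t) \<le> ennreal u * \<phi> x s + ennreal v * \<phi> x t) \<and>
        continuous_on {0..} (\<phi> x) \<and>
        \<phi> x 0 = 0 \<and>
        (\<phi> x \<longlongrightarrow> 0) (at_right 0) \<and>
        (\<phi> x \<longlongrightarrow> \<infinity>) at_top)"

definition modular :: "'a measure \<Rightarrow> ('a \<Rightarrow> real \<Rightarrow> ennreal) \<Rightarrow> ('a \<Rightarrow> real) \<Rightarrow> ennreal" where
  "modular M \<phi> u = (\<integral>\<^sup>+x. \<phi> x \<bar>u x\<bar> \<partial>M)"

text \<open>Elements of \<open>L\<^sup>\<phi>\<close> are represented by functions; equality almost everywhere is not quotiented
  out, so \<open>lux_norm\<close> is a seminorm on this set of functions.\<close>

definition L_Phi :: "'a measure \<Rightarrow> ('a \<Rightarrow> real \<Rightarrow> ennreal) \<Rightarrow> ('a \<Rightarrow> real) set" where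
  "L_Phi M \<phi> = {u \<in> borel_measurable M. \<exists>k>0. modular M \<phi> (\<lambda>x. k * u x) < \<infinity>}"

definition lux_norm :: "'a measure \<Rightarrow> ('a \<Rightarrow> real \<Rightarrow> ennreal) \<Rightarrow> ('a \<Rightarrow> real) \<Rightarrow> real" where
  "lux_norm M \<phi> u = Inf {k. k > 0 \<and> modular M \<phi> (\<lambda>x. u x / k) \<le> 1}"

text \<open>Continuous linear functionals on \<open>L\<^sup>\<phi>\<close>.  Boundedness by the seminorm forces \<open>T\<close> to agree on
  functions that are equal almost everywhere, so these are exactly the functionals on the quotient.
  The values of \<open>T\<close> outside \<open>L_Phi M \<phi>\<close> are irrelevant.\<close>

definition dual_L_Phi ::
  "'a measure \<Rightarrow> ('a \<Rightarrow> real \<Rightarrow> ennreal) \<Rightarrow> (('a \<Rightarrow> real) \<Rightarrow> real) set" where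
  "dual_L_Phi M \<phi> = {T.
     (\<forall>u\<in>L_Phi M \<phi>. \<forall>v\<in>L_Phi M \<phi>. T (\<lambda>x. u x + v x) = T u + T v) \<and>
     (\<forall>c. \<forall>u\<in>L_Phi M \<phi>. T (\<lambda>x. c * u x) = c * T u) \<and>
     (\<exists>K. \<forall>u\<in>L_Phi M \<phi>. \<bar>T u\<bar> \<le> K * lux_norm M \<phi> u)}"

definition weakly_converges ::
  "'a measure \<Rightarrow> ('a \<Rightarrow> real \<Rightarrow> ennreal) \<Rightarrow> (nat \<Rightarrow> 'a \<Rightarrow> real) \<Rightarrow> ('a \<Rightarrow> real) \<Rightarrow> bool" where
  "weakly_converges M \<phi> f g \<longleftrightarrow>
     (\<forall>n. f n \<in> L_Phi M \<phi>) \<and> g \<in> L_Phi M \<phi> \<and>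
     (\<forall>T\<in>dual_L_Phi M \<phi>. (\<lambda>n. T (f n)) \<longlonglongrightarrow> T g)"

definition L_infty :: "'a measure \<Rightarrow> ('a \<Rightarrow> real) set" where
  "L_infty M = {h \<in> borel_measurable M. \<exists>B. AE x in M. \<bar>h x\<bar> \<le> B}"

text \<open>Near each boundary point, \<open>\<Omega>\<close> is, up to a rigid motion, the part of a ball above the graph of
  a Lipschitz function: \<open>\<nu>\<close> is the vertical direction, and \<open>x - (x \<bullet> \<nu>) *\<^sub>R \<nu>\<close> is the horizontal
  component of \<open>x\<close>, in the hyperplane orthogonal to \<open>\<nu>\<close>.\<close>

definition lipschitz_boundary :: "'a::euclidean_space set \<Rightarrow> bool" where
  "lipschitz_boundary \<Omega> \<longleftrightarrow>
     (\<forall>z\<in>frontier \<Omega>. \<exists>r>0. \<exists>\<nu>. norm \<nu> = 1 \<and>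
        (\<exists>\<gamma>::'a \<Rightarrow> real. \<exists>L. L-lipschitz_on {y. y \<bullet> \<nu> = 0} \<gamma> \<and>
           \<Omega> \<inter> ball z r = {x \<in> ball z r. \<gamma> (x - (x \<bullet> \<nu>) *\<^sub>R \<nu>) < x \<bullet> \<nu>}))"

definition bounded_lipschitz_domain :: "'a::euclidean_space set \<Rightarrow> bool" where
  "bounded_lipschitz_domain \<Omega> \<longleftrightarrow>
     open \<Omega> \<and> connected \<Omega> \<and> \<Omega> \<noteq> {} \<and> bounded \<Omega> \<and> lipschitz_boundary \<Omega>"

text \<open>The integral of \<open>\<phi>(x,|u|) h\<close> exists and is finite.  The first conjunct is needed because
  \<^const>\<open>enn2real\<close> maps \<open>\<infinity>\<close> to \<open>0\<close>.\<close>

definition Phi_integrable ::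
  "'a measure \<Rightarrow> ('a \<Rightarrow> real \<Rightarrow> ennreal) \<Rightarrow> ('a \<Rightarrow> real) \<Rightarrow> ('a \<Rightarrow> real) \<Rightarrow> bool" where
  "Phi_integrable M \<phi> u h \<longleftrightarrow>
     (AE x in M. \<phi> x \<bar>u x\<bar> < \<infinity>) \<and> integrable M (\<lambda>x. enn2real (\<phi> x \<bar>u x\<bar>) * h x)"

end

theory Submission
  imports Defs
begin

text \<open>The growth condition at \<open>t = m\<close> is a doubling condition, which forces \<open>\<N>\<close> to be finite and
  makes the modular \<open>\<rho>\<close> finite on all of \<open>L\<^sup>\<N>\<close>.  Given \<open>sup \<rho>(f\<^sub>n) < \<infinity>\<close>, the classical argument
  applies: \<open>(\<bar>\<N>(f\<^sub>n) - \<N>(f - f\<^sub>n) - \<N>(f)\<bar> - \<epsilon> \<N>(f - f\<^sub>n))\<^sup>+\<close> is dominated by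
  \<open>(C\<^sub>\<epsilon> + 1) \<N>(f)\<close> and tends to \<open>0\<close> almost everywhere, while the integral of
  \<open>\<epsilon> \<N>(f - f\<^sub>n)\<close> is \<open>O(\<epsilon>)\<close>.

  Boundedness of \<open>\<rho>(f\<^sub>n)\<close> follows from weak convergence without the Hahn-Banach theorem.  For
  \<open>w = f\<^sub>n / 2\<^sup>j\<close> with \<open>j\<close> the least exponent making \<open>\<rho>(w) \<le> 1\<close>, the functional
  \<open>u \<mapsto> \<integral> u \<N>(x,\<bar>w\<bar>)/w\<close> is bounded by \<open>\<rho>(u) + \<rho>(w)\<close> by convexity, and its value at \<open>f\<^sub>n\<close> is
  \<open>2\<^sup>j \<rho>(w) \<ge> 2\<^sup>j / K\<close> with \<open>K\<close> the doubling constant.  If \<open>\<rho>(f\<^sub>n)\<close> were unbounded, a gliding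
  hump would combine these functionals into one that is unbounded along \<open>f\<^sub>n\<close>.\<close>

section \<open>Grid approximation and gliding humps\<close>

text \<open>Rounding down to a multiple of 1/(n+1) leaves countably many values. This reduces
  measurability of a composition, and inequalities known almost everywhere only for fixed arguments,
  to countably many arguments. The cut-off by \<open>nat\<close> keeps the grid nonnegative for
  every real \<open>t\<close>.\<close>

definition grid :: "nat \<Rightarrow> real \<Rightarrow> real" where
  "grid n t = real (nat \<lfloor>real (Suc n) * t\<rfloor>) / real (Suc n)"

lemma grid_nonneg: "0 \<le> grid n t"
  by (simp add: grid_def)

lemma tendsto_grid:
  assumes "0 \<le> t"
  shows "(\<lambda>n. grid n t) \<longlonglongrightarrow> t"
proof (rule tendsto_sandwich)
  have eq: "grid n t = of_int \<lfloor>real (Suc n) * t\<rfloor> / real (Suc n)" for n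
    using assms by (simp add: grid_def)
  show "\<forall>\<^sub>F n in sequentially. t - 1 / real (Suc n) \<le> grid n t"
  proof (rule always_eventually, rule allI)
    fix n
    have "real (Suc n) * t - 1 \<le> of_int \<lfloor>real (Suc n) * t\<rfloor>" by linarith
    then have "(real (Suc n) * t - 1) / real (Suc n) \<le> of_int \<lfloor>real (Suc n) * t\<rfloor> / real (Suc n)"
      by (intro divide_right_mono) auto
    then show "t - 1 / real (Suc n) \<le> grid n t"
      unfolding eq by (simp add: diff_divide_distrib del: of_nat_Suc)
  qed
  show "\<forall>\<^sub>F n in sequentially. grid n t \<le> t"
  proof (rule always_eventually, rule allI)
    fix n
    have "of_int \<lfloor>real (Suc n) * t\<rfloor> / real (Suc n) \<le> (real (Suc n) * t) / real (Suc n)"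
      by (intro divide_right_mono) auto
    then show "grid n t \<le> t"
      unfolding eq by (simp del: of_nat_Suc)
  qed
  show "(\<lambda>n. t - 1 / real (Suc n)) \<longlonglongrightarrow> t"
    using LIMSEQ_inverse_real_of_nat_add_minus[of t] by (simp add: inverse_eq_divide)
qed auto

text \<open>The signs of the coefficients are chosen one by one so that the diagonal term adds to the partial
  sum before it; the ratio \<open>r\<close> is small enough for the tail not to cancel the diagonal term.\<close>
lemma gliding_hump:
  fixes S :: "nat \<Rightarrow> nat \<Rightarrow> real" and a :: "nat \<Rightarrow> real"
  assumes S_le: "\<And>i n. \<bar>S i n\<bar> \<le> B * a n"
    and S_diag: "\<And>n. c * a n \<le> S n n"
    and c: "0 < c" and B: "0 < B"
    and unbounded: "\<And>R. \<exists>n. R \<le> a n"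
  obtains s :: "nat \<Rightarrow> nat" and e :: "nat \<Rightarrow> real"
  where "summable (\<lambda>k. \<bar>e k\<bar>)" "\<not> Bseq (\<lambda>n. \<Sum>k. e k * S (s k) n)"
proof -
  \<comment> \<open>This ratio solves B r / (1 - r) = c / 4, so the terms after the k-th amount to
    at most a quarter of the lower bound for the k-th one.\<close>
  define r where "r = c / (4 * B + c)"
  have r: "0 < r" "r < 1" using c B by (auto simp: r_def field_simps)
  have "1 - r = 4 * B / (4 * B + c)" using c B by (simp add: r_def field_simps)
  then have r_eq: "B * (r / (1 - r)) = c / 4" using c B by (simp add: r_def)
  \<comment> \<open>The column \<open>s k\<close> has \<open>a\<close> so large that the weight
    \<open>r ^ k\<close> still leaves at least \<open>k\<close>.\<close>
  define s where "s k = (SOME n. real k / r ^ k \<le> a n)" for k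
  have s: "real k / r ^ k \<le> a (s k)" for k
    unfolding s_def using unbounded by (rule someI_ex)
  have a_nonneg: "0 \<le> a n" for n
  proof -
    have "0 \<le> B * a n" using S_le[of n n] by linarith
    then show ?thesis using B by (simp add: zero_le_mult_iff)
  qed
  define sg where "sg y = (if 0 \<le> y then 1 else - 1 :: real)" for y :: real
  have sg [simp]: "\<bar>sg y\<bar> = 1" for y by (simp add: sg_def)
  \<comment> \<open>The partial sums are built as functions of \<open>n\<close> by recursion,
    because the sign of the k-th coefficient depends on the value of the previous partial sum at
    \<open>s k\<close>.\<close>
  define P where "P = rec_nat (\<lambda>n. 0) (\<lambda>k p n. p n + sg (p (s k)) * r ^ k * S (s k) n)"
  have P_0: "P 0 n = 0" and P_Suc: "P (Suc k) n = P k n + sg (P k (s k)) * r ^ k * S (s k) n" for k n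
    by (simp_all add: P_def)
  define e where "e k = sg (P k (s k)) * r ^ k" for k
  have e_abs: "\<bar>e k\<bar> = r ^ k" for k using r by (simp add: e_def abs_mult)
  have P_sum: "P k n = (\<Sum>i<k. e i * S (s i) n)" for k n
    by (induction k) (simp_all add: P_0 P_Suc e_def)
  have term_le: "\<bar>e k * S (s k) n\<bar> \<le> r ^ k * (B * a n)" for k n
    unfolding abs_mult e_abs using S_le r by (intro mult_left_mono) auto
  have sum_r: "summable (\<lambda>k. r ^ k * (B * a n))" for n
    using r by (intro summable_mult2 summable_geometric) auto
  have summ: "summable (\<lambda>k. e k * S (s k) n)" for n
    using term_le by (intro summable_comparison_test'[OF sum_r]) simp
  have big: "c / 2 * real k \<le> \<bar>\<Sum>i. e i * S (s i) (s k)\<bar>" for k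
  proof -
    let ?n = "s k"
    have "\<bar>\<Sum>i. e (i + Suc k) * S (s (i + Suc k)) ?n\<bar> \<le> (\<Sum>i. r ^ (i + Suc k) * (B * a ?n))"
    proof (rule order_trans[OF summable_rabs suminf_le])
      show s1: "summable (\<lambda>i. \<bar>e (i + Suc k) * S (s (i + Suc k)) ?n\<bar>)"
        using term_le
        by (intro summable_comparison_test'[OF summable_ignore_initial_segment[OF sum_r], of 0 _ "Suc k" ?n])
          (simp del: add_Suc_right)
      then show "summable (\<lambda>i. \<bar>e (i + Suc k) * S (s (i + Suc k)) ?n\<bar>)" .
      show "summable (\<lambda>i. r ^ (i + Suc k) * (B * a ?n))"
        by (rule summable_ignore_initial_segment[OF sum_r])
    qed (rule term_le)
    also have "\<dots> = (\<Sum>i. r ^ i * (r ^ Suc k * (B * a ?n)))"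
      by (simp add: power_add mult_ac)
    also have "\<dots> = 1 / (1 - r) * (r ^ Suc k * (B * a ?n))"
      using r by (subst suminf_mult2[symmetric]) (auto simp: suminf_geometric)
    also have "\<dots> = B * (r / (1 - r)) * (r ^ k * a ?n)" by simp
    also have "\<dots> = c / 4 * (r ^ k * a ?n)" by (simp only: r_eq)
    finally have tail: "\<bar>\<Sum>i. e (i + Suc k) * S (s (i + Suc k)) ?n\<bar> \<le> c / 4 * (r ^ k * a ?n)" .
    have diag: "0 \<le> r ^ k * (c * a ?n)" "r ^ k * (c * a ?n) \<le> r ^ k * S ?n ?n"
      using r c a_nonneg S_diag by (auto intro!: mult_left_mono)
    have "r ^ k * (c * a ?n) \<le> \<bar>P (Suc k) ?n\<bar>"
      using diag by (auto simp: P_Suc sg_def)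
    moreover have "(\<Sum>i. e i * S (s i) ?n) = (\<Sum>i. e (i + Suc k) * S (s (i + Suc k)) ?n) + P (Suc k) ?n"
      unfolding P_sum by (rule suminf_split_initial_segment[OF summ])
    \<comment> \<open>Head minus tail leaves three quarters of the diagonal bound; the claimed
      factor c / 2 is a weaker round number.\<close>
    ultimately have "c * (r ^ k * a ?n) - c / 4 * (r ^ k * a ?n) \<le> \<bar>\<Sum>i. e i * S (s i) ?n\<bar>"
      using tail unfolding mult.left_commute[of _ c] by linarith
    moreover have "real k \<le> r ^ k * a ?n"
      using s[of k] r by (simp add: field_simps)
    then have "c * real k \<le> c * (r ^ k * a ?n)" using c by (intro mult_left_mono) auto
    moreover have "0 \<le> c * (r ^ k * a ?n)" using r c a_nonneg by auto
    ultimately show ?thesis by (simp add: field_simps)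
  qed
  have "\<not> Bseq (\<lambda>n. \<Sum>k. e k * S (s k) n)"
  proof
    assume "Bseq (\<lambda>n. \<Sum>k. e k * S (s k) n)"
    then obtain R where R: "\<And>n. \<bar>\<Sum>k. e k * S (s k) n\<bar> \<le> R" by (auto simp: Bseq_def)
    obtain k :: nat where "R / (c / 2) < real k" using reals_Archimedean2 by blast
    then have "R < c / 2 * real k" using c by (simp add: field_simps)
    with big[of k] R[of "s k"] show False by linarith
  qed
  moreover have "summable (\<lambda>k. \<bar>e k\<bar>)"
    unfolding e_abs using r by (intro summable_geometric) auto
  ultimately show thesis using that by blast
qed

section \<open>Modulars of convex doubling integrands\<close>

lemma integrable_mult_bounded:
  fixes v h :: "'a \<Rightarrow> real"
  assumes v: "integrable M v" and h: "h \<in> borel_measurable M" and h_le: "AE x in M. \<bar>h x\<bar> \<le> B"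
  shows "integrable M (\<lambda>x. v x * h x)"
proof (rule Bochner_Integration.integrable_bound)
  show "integrable M (\<lambda>x. B * v x)" using v by simp
  show "AE x in M. norm (v x * h x) \<le> norm (B * v x)"
    using h_le
  proof eventually_elim
    case (elim x)
    then have "\<bar>v x\<bar> * \<bar>h x\<bar> \<le> \<bar>v x\<bar> * \<bar>B\<bar>" by (intro mult_left_mono) auto
    then show ?case by (simp add: abs_mult mult.commute)
  qed
qed (use v h in measurable)

text \<open>The pointwise conditions are imposed at every \<open>x\<close>, which keeps exceptional
  sets out of the estimates; a given integrand is first altered on a null set to satisfy
  them.\<close>

locale doubling_Phi =
  fixes M :: "'a measure" and F :: "'a \<Rightarrow> real \<Rightarrow> real" and K :: real
  assumes measurable_F: "0 \<le> t \<Longrightarrow> (\<lambda>x. F x t) \<in> borel_measurable M"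
    and convex: "convex_on {0..} (F x)"
    and continuous: "continuous_on {0..} (F x)"
    and mono: "mono_on {0..} (F x)"
    and zero [simp]: "F x 0 = 0"
    and doubling: "0 \<le> t \<Longrightarrow> F x (2 * t) \<le> K * F x t"
    and K_ge_1: "1 \<le> K"
begin

lemma K_pos: "0 < K"
  using K_ge_1 by simp

lemma F_mono: "0 \<le> s \<Longrightarrow> s \<le> t \<Longrightarrow> F x s \<le> F x t"
  using mono_onD[OF mono] by simp

lemma F_nonneg: "0 \<le> t \<Longrightarrow> 0 \<le> F x t"
  using F_mono[of 0 t x] by simp

lemma F_scale_le: "0 \<le> c \<Longrightarrow> c \<le> 1 \<Longrightarrow> 0 \<le> t \<Longrightarrow> F x (c * t) \<le> c * F x t"
  using convex_onD[OF convex, of c 0 t x] by simp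

lemma F_pow_le: "0 \<le> t \<Longrightarrow> F x (2 ^ n * t) \<le> K ^ n * F x t"
proof (induction n)
  case (Suc n)
  have "F x (2 ^ Suc n * t) \<le> K * F x (2 ^ n * t)"
    using doubling[of "2 ^ n * t" x] Suc.prems by (simp add: mult.assoc)
  also have "\<dots> \<le> K * (K ^ n * F x t)"
    using Suc K_pos by (intro mult_left_mono) auto
  finally show ?case by (simp add: mult_ac)
qed simp

lemma F_add_le:
  assumes "0 \<le> s" "0 \<le> t"
  shows "F x (s + t) \<le> K * (F x s + F x t)"
proof -
  have "F x (s + t) \<le> F x (2 * max s t)"
    using assms by (intro F_mono) auto
  also have "\<dots> \<le> K * F x (max s t)"
    using assms by (intro doubling) auto
  also have "\<dots> \<le> K * (F x s + F x t)"
    using assms K_pos by (intro mult_left_mono) (auto simp: max_def F_nonneg)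
  finally show ?thesis .
qed

lemma tendsto_F:
  assumes "u \<longlonglongrightarrow> l" "\<And>n. 0 \<le> u n"
  shows "(\<lambda>n. F x (u n)) \<longlonglongrightarrow> F x l"
proof (rule continuous_on_tendsto_compose[OF continuous assms(1)])
  show "l \<in> {0..}" using LIMSEQ_le_const[OF assms(1), of 0] assms(2) by auto
qed (use assms(2) in auto)

text \<open>Measurability in \<open>x\<close> is given only at fixed arguments. With
  \<open>u\<close> rounded to the grid the composition is a countable case distinction over such
  arguments, and continuity in the second variable passes to the limit.\<close>

lemma measurable_F_comp [measurable]:
  assumes [measurable]: "u \<in> borel_measurable M"
  shows "(\<lambda>x. F x \<bar>u x\<bar>) \<in> borel_measurable M"
proof (rule borel_measurable_LIMSEQ_real)
  fix n
  have "(\<lambda>x. F x (real i / real (Suc n))) \<in> borel_measurable M" for i :: nat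
    by (intro measurable_F) auto
  then have "(\<lambda>x. F x (real (nat \<lfloor>real (Suc n) * \<bar>u x\<bar>\<rfloor>) / real (Suc n))) \<in> borel_measurable M"
    by (rule measurable_compose_countable) measurable
  then show "(\<lambda>x. F x (grid n \<bar>u x\<bar>)) \<in> borel_measurable M"
    by (simp add: grid_def)
  show "(\<lambda>n. F x (grid n \<bar>u x\<bar>)) \<longlonglongrightarrow> F x \<bar>u x\<bar>" for x
    by (intro tendsto_F tendsto_grid grid_nonneg) simp
qed

section \<open>The Orlicz space of a doubling integrand and its modular\<close>

text \<open>Integrability is asked of \<open>u\<close> itself rather than of some positive multiple;
  under doubling the two conditions define the same set.\<close>

definition orlicz :: "('a \<Rightarrow> real) set" where
  "orlicz = {u \<in> borel_measurable M. integrable M (\<lambda>x. F x \<bar>u x\<bar>)}"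

definition rho :: "('a \<Rightarrow> real) \<Rightarrow> real" where
  "rho u = (LINT x|M. F x \<bar>u x\<bar>)"

lemma orlicz_measurable: "u \<in> orlicz \<Longrightarrow> u \<in> borel_measurable M"
  and orlicz_integrable: "u \<in> orlicz \<Longrightarrow> integrable M (\<lambda>x. F x \<bar>u x\<bar>)"
  by (auto simp: orlicz_def)

lemma orliczI_bound:
  assumes "u \<in> borel_measurable M" "integrable M w" "\<And>x. F x \<bar>u x\<bar> \<le> w x"
  shows "u \<in> orlicz"
  unfolding orlicz_def
proof (intro CollectI conjI assms(1))
  show "integrable M (\<lambda>x. F x \<bar>u x\<bar>)"
  proof (rule Bochner_Integration.integrable_bound[OF assms(2)])
    show "AE x in M. norm (F x \<bar>u x\<bar>) \<le> norm (w x)"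
      using assms(3) F_nonneg by (intro AE_I2) (fastforce intro: order_trans[OF _ abs_ge_self])
  qed (use assms(1) in measurable)
qed

lemma rho_nonneg: "0 \<le> rho u"
  unfolding rho_def by (intro integral_nonneg_AE AE_I2 F_nonneg) simp

text \<open>Doubling is iterated until the power of 2 exceeds the modulus of
  \<open>c\<close>.\<close>

lemma orlicz_scale:
  assumes "u \<in> orlicz"
  shows "(\<lambda>x. c * u x) \<in> orlicz"
proof -
  obtain n :: nat where "\<bar>c\<bar> < 2 ^ n" using real_arch_pow[of 2 "\<bar>c\<bar>"] by auto
  then have "F x \<bar>c * u x\<bar> \<le> K ^ n * F x \<bar>u x\<bar>" for x
    by (intro order_trans[OF F_mono F_pow_le]) (auto simp: abs_mult intro!: mult_right_mono)
  then show ?thesis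
    using orlicz_integrable[OF assms] orlicz_measurable[OF assms]
    by (intro orliczI_bound[where w = "\<lambda>x. K ^ n * F x \<bar>u x\<bar>"]) auto
qed

lemma F_add_abs_le: "F x \<bar>a + b\<bar> \<le> K * (F x \<bar>a\<bar> + F x \<bar>b\<bar>)"
  by (rule order_trans[OF F_mono F_add_le]) auto

lemma orlicz_add:
  assumes "u \<in> orlicz" "v \<in> orlicz"
  shows "(\<lambda>x. u x + v x) \<in> orlicz"
  using assms[THEN orlicz_integrable] assms[THEN orlicz_measurable] F_add_abs_le
  by (intro orliczI_bound[where w = "\<lambda>x. K * (F x \<bar>u x\<bar> + F x \<bar>v x\<bar>)"]) auto

lemma orlicz_diff:
  assumes "u \<in> orlicz" "v \<in> orlicz"
  shows "(\<lambda>x. u x - v x) \<in> orlicz"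
  using orlicz_add[OF assms(1) orlicz_scale[OF assms(2), of "-1"]] by simp

lemma rho_diff_le:
  assumes "u \<in> orlicz" "v \<in> orlicz"
  shows "rho (\<lambda>x. u x - v x) \<le> K * (rho u + rho v)"
proof -
  have "rho (\<lambda>x. u x - v x) \<le> (LINT x|M. K * (F x \<bar>u x\<bar> + F x \<bar>v x\<bar>))"
    unfolding rho_def
    using orlicz_diff[OF assms, THEN orlicz_integrable] assms[THEN orlicz_integrable]
      F_add_abs_le[of _ "u _" "- v _"]
    by (intro integral_mono) auto
  also have "\<dots> = K * (rho u + rho v)"
    using assms[THEN orlicz_integrable] by (simp add: rho_def)
  finally show ?thesis .
qed

lemma rho_scale_le:
  assumes "u \<in> orlicz" "0 \<le> c" "c \<le> 1"
  shows "rho (\<lambda>x. c * u x) \<le> c * rho u"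
proof -
  have "rho (\<lambda>x. c * u x) \<le> (LINT x|M. c * F x \<bar>u x\<bar>)"
    unfolding rho_def
    using orlicz_integrable[OF assms(1)] orlicz_integrable[OF orlicz_scale[OF assms(1), of c]] assms(2,3)
    by (intro integral_mono) (auto simp: abs_mult F_scale_le)
  then show ?thesis by (simp add: rho_def)
qed

lemma rho_pow_le:
  assumes "u \<in> orlicz"
  shows "rho (\<lambda>x. 2 ^ n * u x) \<le> K ^ n * rho u"
proof -
  have "rho (\<lambda>x. 2 ^ n * u x) \<le> (LINT x|M. K ^ n * F x \<bar>u x\<bar>)"
    unfolding rho_def
    using orlicz_integrable[OF assms(1)] orlicz_integrable[OF orlicz_scale[OF assms(1), of "2 ^ n"]]
    by (intro integral_mono) (auto simp: abs_mult F_pow_le)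
  then show ?thesis by (simp add: rho_def)
qed

text \<open>At \<open>w x = 0\<close> the integrand is \<open>0\<close> because \<open>y / 0 = 0\<close>.\<close>
definition pairing :: "('a \<Rightarrow> real) \<Rightarrow> ('a \<Rightarrow> real) \<Rightarrow> real" where
  "pairing w u = (LINT x|M. u x * (F x \<bar>w x\<bar> / w x))"

text \<open>A substitute for Young's inequality. If |a| \<le> |b|, the left side is at most F(|b|).
  Otherwise convexity and F(0) = 0 make F(t)/t nondecreasing, so F(|b|)/|b| \<le> F(|a|)/|a| and the
  left side is at most F(|a|).\<close>

lemma pairing_integrand_le: "\<bar>a * (F x \<bar>b\<bar> / b)\<bar> \<le> F x \<bar>a\<bar> + F x \<bar>b\<bar>"
proof (cases "b = 0 \<or> \<bar>a\<bar> \<le> \<bar>b\<bar>")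
  case True
  have "\<bar>a * (F x \<bar>b\<bar> / b)\<bar> \<le> F x \<bar>b\<bar>"
  proof (cases "b = 0")
    case False
    then have "\<bar>a\<bar> * F x \<bar>b\<bar> \<le> \<bar>b\<bar> * F x \<bar>b\<bar>"
      using True by (intro mult_right_mono) (auto simp: F_nonneg)
    with False show ?thesis by (simp add: abs_mult F_nonneg field_simps)
  qed simp
  then show ?thesis using F_nonneg[of "\<bar>a\<bar>" x] by simp
next
  case False
  then have "F x (\<bar>b\<bar> / \<bar>a\<bar> * \<bar>a\<bar>) \<le> \<bar>b\<bar> / \<bar>a\<bar> * F x \<bar>a\<bar>"
    by (intro F_scale_le) auto
  with False have "\<bar>a\<bar> * F x \<bar>b\<bar> \<le> \<bar>b\<bar> * F x \<bar>a\<bar>"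
    by (auto simp: field_simps split: if_splits)
  with False have "\<bar>a * (F x \<bar>b\<bar> / b)\<bar> \<le> F x \<bar>a\<bar>"
    by (simp add: abs_mult F_nonneg field_simps)
  then show ?thesis using F_nonneg[of "\<bar>b\<bar>" x] by simp
qed

lemma integrable_pairing:
  assumes "u \<in> orlicz" "w \<in> orlicz"
  shows "integrable M (\<lambda>x. u x * (F x \<bar>w x\<bar> / w x))"
proof (rule Bochner_Integration.integrable_bound)
  show "integrable M (\<lambda>x. F x \<bar>u x\<bar> + F x \<bar>w x\<bar>)"
    using assms[THEN orlicz_integrable] by simp
  show "(\<lambda>x. u x * (F x \<bar>w x\<bar> / w x)) \<in> borel_measurable M"
    using assms[THEN orlicz_measurable] by measurable
  show "AE x in M. norm (u x * (F x \<bar>w x\<bar> / w x)) \<le> norm (F x \<bar>u x\<bar> + F x \<bar>w x\<bar>)"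
    using pairing_integrand_le by (intro AE_I2) (auto intro: order_trans[OF _ abs_ge_self])
qed

lemma abs_pairing_le:
  assumes "u \<in> orlicz" "w \<in> orlicz"
  shows "\<bar>pairing w u\<bar> \<le> rho u + rho w"
proof -
  have "\<bar>pairing w u\<bar> \<le> (LINT x|M. F x \<bar>u x\<bar> + F x \<bar>w x\<bar>)"
    unfolding pairing_def
    using assms[THEN orlicz_integrable] integrable_pairing[OF assms] pairing_integrand_le
    by (intro integral_abs_bound[THEN order_trans] integral_mono) (auto simp del: times_divide_eq_right)
  then show ?thesis using assms[THEN orlicz_integrable] by (simp add: rho_def)
qed

lemma pairing_add:
  "u \<in> orlicz \<Longrightarrow> v \<in> orlicz \<Longrightarrow> w \<in> orlicz \<Longrightarrow>
    pairing w (\<lambda>x. u x + v x) = pairing w u + pairing w v"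
  unfolding pairing_def distrib_right
  by (rule Bochner_Integration.integral_add) (rule integrable_pairing; assumption)+

lemma pairing_scale: "pairing w (\<lambda>x. c * u x) = c * pairing w u"
  unfolding pairing_def by (simp add: mult.assoc del: times_divide_eq_right)

lemma pairing_self: "pairing w w = rho w"
  unfolding pairing_def rho_def by (intro Bochner_Integration.integral_cong) auto

section \<open>Normalization by powers of 2 and unbounded functionals\<close>

text \<open>Convexity gives rho(u / 2^i) \<le> rho(u) / 2^i, so repeated halving brings the modular
  down to 1. At the least such exponent the previous modular still exceeded 1, and undoing one
  halving costs at most the factor \<open>K\<close>. The last bound shows that a large modular
  forces a large exponent.\<close>

lemma ex_normalization:
  assumes "u \<in> orlicz"
  shows "\<exists>j. rho (\<lambda>x. u x / 2 ^ j) \<le> 1 \<and> (1 < rho u \<longrightarrow> 1 < K * rho (\<lambda>x. u x / 2 ^ j))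
    \<and> rho u \<le> max 1 (K ^ j)"
proof -
  have in_o: "(\<lambda>x. u x / 2 ^ j) \<in> orlicz" for j
    using orlicz_scale[OF assms, of "1 / 2 ^ j"] by simp
  obtain i :: nat where "rho u < 2 ^ i" using real_arch_pow[of 2 "rho u"] by auto
  moreover have "rho (\<lambda>x. u x / 2 ^ i) \<le> rho u / 2 ^ i"
    using rho_scale_le[OF assms, of "1 / 2 ^ i"] by simp
  moreover have "rho u / 2 ^ i \<le> 1" if "rho u < 2 ^ i" using that by simp
  ultimately have ex: "rho (\<lambda>x. u x / 2 ^ i) \<le> 1" by linarith
  define j where "j = (LEAST j. rho (\<lambda>x. u x / 2 ^ j) \<le> 1)"
  have j: "rho (\<lambda>x. u x / 2 ^ j) \<le> 1"
    unfolding j_def using ex by (rule LeastI)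
  have "1 < K * rho (\<lambda>x. u x / 2 ^ j)" if "1 < rho u"
  proof (cases j)
    case 0
    with j that show ?thesis by simp
  next
    case (Suc i)
    then have "1 < rho (\<lambda>x. u x / 2 ^ i)"
      using not_less_Least[of i "\<lambda>j. rho (\<lambda>x. u x / 2 ^ j) \<le> 1"] by (simp add: j_def)
    also have "\<dots> \<le> K * rho (\<lambda>x. u x / 2 ^ j)"
      using rho_pow_le[OF in_o[of j], of 1] Suc by simp
    finally show ?thesis .
  qed
  moreover have "rho u \<le> max 1 (K ^ j)"
  proof -
    have "rho u \<le> K ^ j * rho (\<lambda>x. u x / 2 ^ j)"
      using rho_pow_le[OF in_o[of j], of j] by simp
    also have "\<dots> \<le> K ^ j" using j K_pos by (simp add: mult_left_le)
    finally show ?thesis by simp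
  qed
  ultimately show ?thesis using j by blast
qed

text \<open>The functionals \<open>pairing (w i)\<close> are uniformly bounded on the set where
  \<open>rho\<close> is at most 1, so every series of them with absolutely summable coefficients is
  bounded there too. The gliding hump picks coefficients for which the series is unbounded along
  \<open>f n\<close>.\<close>

lemma ex_unbounded_functional:
  assumes f: "\<And>n. f n \<in> orlicz" and unbounded: "\<not> Bseq (\<lambda>n. rho (f n))"
  obtains T :: "('a \<Rightarrow> real) \<Rightarrow> real" and C
  where "\<And>u v. u \<in> orlicz \<Longrightarrow> v \<in> orlicz \<Longrightarrow> T (\<lambda>x. u x + v x) = T u + T v"
    and "\<And>c u. u \<in> orlicz \<Longrightarrow> T (\<lambda>x. c * u x) = c * T u"
    and "\<And>u. u \<in> orlicz \<Longrightarrow> rho u \<le> 1 \<Longrightarrow> \<bar>T u\<bar> \<le> C"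
    and "\<not> Bseq (\<lambda>n. T (f n))"
proof -
  have "\<exists>m. R < rho (f m)" for R
  proof (rule ccontr)
    assume "\<nexists>m. R < rho (f m)"
    then have "norm (rho (f m)) \<le> R" for m using rho_nonneg[of "f m"] by (simp add: not_less)
    then show False using unbounded BseqI'[of "\<lambda>n. rho (f n)" R] by simp
  qed
  \<comment> \<open>The bound 1 activates the lower estimate of \<open>ex_normalization\<close>; the
    bound \<open>n\<close> makes the exponents \<open>j n\<close> unbounded.\<close>
  then have "\<forall>n. \<exists>m. max 1 (real n) < rho (f m)" by blast
  from choice[OF this] obtain \<sigma> where \<sigma>: "\<And>n. max 1 (real n) < rho (f (\<sigma> n))"
    by blast
  define g where "g n = f (\<sigma> n)" for n
  have g: "g n \<in> orlicz" for n by (simp add: g_def f)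
  have rho_g: "1 < rho (g n)" "real n < rho (g n)" for n using \<sigma>[of n] by (auto simp: g_def)
  obtain j where j: "rho (\<lambda>x. g n x / 2 ^ j n) \<le> 1" "1 < K * rho (\<lambda>x. g n x / 2 ^ j n)"
      "rho (g n) \<le> max 1 (K ^ j n)" for n
    using ex_normalization[OF g] rho_g(1) by metis
  define w where "w n = (\<lambda>x. g n x / 2 ^ j n)" for n
  have w: "w n \<in> orlicz" for n
    using orlicz_scale[OF g, of "1 / 2 ^ j n" n] by (simp add: w_def)
  have g_w: "g n = (\<lambda>x. 2 ^ j n * w n x)" for n by (simp add: w_def)
  have rho_w: "rho (w n) \<le> 1" "1 / K \<le> rho (w n)" for n
    using j(1,2)[of n] K_pos by (auto simp: w_def field_simps)
  have bound: "\<bar>pairing (w i) u\<bar> \<le> rho u + 1" if "u \<in> orlicz" for i u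
    using abs_pairing_le[OF that w[of i]] rho_w(1)[of i] by linarith
  obtain s e where e: "summable (\<lambda>k. \<bar>e k\<bar>)"
    and hump: "\<not> Bseq (\<lambda>n. \<Sum>k. e k * pairing (w (s k)) (g n))"
  proof (rule gliding_hump[of "\<lambda>i n. pairing (w i) (g n)" 2 "\<lambda>n. 2 ^ j n" "1 / K"])
    \<comment> \<open>Homogeneity extracts 2^(j n), and the remaining pairing of \<open>w i\<close>
      with \<open>w n\<close> is at most rho(w n) + 1 \<le> 2.\<close>
    show "\<bar>pairing (w i) (g n)\<bar> \<le> 2 * 2 ^ j n" for i n
      using bound[OF w, of i n] rho_w(1)[of n]
      by (simp add: g_w pairing_scale abs_mult)
    show "1 / K * 2 ^ j n \<le> pairing (w n) (g n)" for n
      unfolding g_w[of n] pairing_scale pairing_self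
      using mult_right_mono[OF rho_w(2)[of n], of "2 ^ j n"] by (simp add: mult.commute)
    show "\<exists>n. R \<le> 2 ^ j n" for R :: real
    proof -
      obtain p :: nat where p: "R < 2 ^ p" using real_arch_pow[of 2 R] by auto
      obtain n :: nat where n: "max 1 (K ^ p) < real n" using reals_Archimedean2 by blast
      \<comment> \<open>A smaller exponent would give rho(g n) \<le> max 1 (K^p) < n, against the
        choice of \<open>g n\<close>.\<close>
      have "p \<le> j n"
      proof (rule ccontr)
        assume "\<not> p \<le> j n"
        then have "K ^ j n \<le> K ^ p" using K_ge_1 by (intro power_increasing) auto
        with n j(3)[of n] rho_g(2)[of n] show False by linarith
      qed
      then have "(2 :: real) ^ p \<le> 2 ^ j n" by (intro power_increasing) auto
      with p show ?thesis by (intro exI[of _ n]) linarith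
    qed
  qed (use K_pos in auto)
  define T where "T u = (\<Sum>k. e k * pairing (w (s k)) u)" for u
  have term_le: "\<bar>e k * pairing (w (s k)) u\<bar> \<le> \<bar>e k\<bar> * (rho u + 1)" if "u \<in> orlicz" for k u
    unfolding abs_mult using bound[OF that] by (intro mult_left_mono) auto
  have summ_abs: "summable (\<lambda>k. \<bar>e k * pairing (w (s k)) u\<bar>)" if "u \<in> orlicz" for u
    using term_le[OF that] by (intro summable_comparison_test'[OF summable_mult2[OF e]]) simp
  note summ = summable_rabs_cancel[OF summ_abs]
  show thesis
  proof (rule that[of T "(\<Sum>k. \<bar>e k\<bar>) * 2"])
    show "T (\<lambda>x. u x + v x) = T u + T v" if "u \<in> orlicz" "v \<in> orlicz" for u v
      unfolding T_def using that by (simp add: pairing_add w distrib_left suminf_add[OF summ summ])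
    show "T (\<lambda>x. c * u x) = c * T u" if "u \<in> orlicz" for c u
      unfolding T_def pairing_scale mult.left_commute[of _ c] by (rule suminf_mult[OF summ[OF that]])
    show "\<bar>T u\<bar> \<le> (\<Sum>k. \<bar>e k\<bar>) * 2" if u: "u \<in> orlicz" "rho u \<le> 1" for u
    proof -
      have "\<bar>T u\<bar> \<le> (\<Sum>k. \<bar>e k\<bar> * (rho u + 1))"
        unfolding T_def
        by (intro summable_rabs[OF summ_abs, THEN order_trans] suminf_le term_le summ_abs
            summable_mult2 e u)
      also have "\<dots> = (\<Sum>k. \<bar>e k\<bar>) * (rho u + 1)" by (rule suminf_mult2[symmetric, OF e])
      also have "\<dots> \<le> (\<Sum>k. \<bar>e k\<bar>) * 2"
        using u e by (intro mult_left_mono suminf_nonneg) auto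
      finally show ?thesis .
    qed
    show "\<not> Bseq (\<lambda>n. T (f n))"
    proof
      assume "Bseq (\<lambda>n. T (f n))"
      then have "Bseq (\<lambda>n. T (g n))" by (auto simp: g_def Bseq_def)
      with hump show False by (simp add: T_def)
    qed
  qed
qed

section \<open>The limit theorem for real-valued integrands\<close>

lemma Brezis_Lieb:
  assumes growth: "\<And>\<epsilon>. 0 < \<epsilon> \<Longrightarrow>
      \<exists>C. \<forall>x. \<forall>t\<ge>0. \<forall>m\<ge>0. \<bar>F x (t + m) - F x t\<bar> \<le> C * F x m + \<epsilon> * F x t"
    and f: "\<And>n. f n \<in> orlicz" and g: "g \<in> orlicz"
    and conv: "AE x in M. (\<lambda>n. f n x) \<longlonglongrightarrow> g x"
    and bounded: "Bseq (\<lambda>n. rho (f n))"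
    and h [measurable]: "h \<in> borel_measurable M" and h_le: "AE x in M. \<bar>h x\<bar> \<le> B"
  shows "(\<lambda>n. (LINT x|M. F x \<bar>f n x\<bar> * h x) - (LINT x|M. F x \<bar>g x - f n x\<bar> * h x))
    \<longlonglongrightarrow> (LINT x|M. F x \<bar>g x\<bar> * h x)"
proof -
  have d: "(\<lambda>x. g x - f n x) \<in> orlicz" for n by (intro orlicz_diff f g)
  note [measurable] = f[THEN orlicz_measurable] orlicz_measurable[OF g]
  note [simp] = f[THEN orlicz_integrable] orlicz_integrable[OF g] d[THEN orlicz_integrable]
  note int_h [simp] = integrable_mult_bounded[OF _ h h_le]
  obtain R where R: "0 < R" "\<And>n. rho (f n) \<le> R"
    using bounded by (rule BseqE) (simp add: rho_nonneg)
  define R' where "R' = K * (rho g + R)"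
  have R': "0 < R'" using K_pos R rho_nonneg[of g] by (simp add: R'_def)
  have rho_d: "rho (\<lambda>x. g x - f n x) \<le> R'" for n
    unfolding R'_def using K_pos R(2)
    by (intro order_trans[OF rho_diff_le[OF g f]] mult_left_mono) auto
  \<comment> \<open>Convergence of \<open>D n\<close> to 0 in mean handles every bounded weight
    \<open>h\<close> at once.\<close>
  define D where "D n = (\<lambda>x. F x \<bar>f n x\<bar> - F x \<bar>g x - f n x\<bar> - F x \<bar>g x\<bar>)" for n
  have D_int [simp]: "integrable M (D n)" for n by (simp add: D_def)
  have D_lim: "(\<lambda>n. LINT x|M. \<bar>D n x\<bar>) \<longlonglongrightarrow> 0"
  proof (rule LIMSEQ_I)
    fix r :: real assume r: "0 < r"
    \<comment> \<open>Half of \<open>r\<close> is spent on the \<epsilon>-term, whose modular is at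
      most \<open>R'\<close> for all \<open>n\<close>; the other half is for the integral of
      \<open>G n\<close>.\<close>
    define \<epsilon> where "\<epsilon> = r / (2 * R')"
    have \<epsilon>: "0 < \<epsilon>" "\<epsilon> * R' = r / 2" using r R' by (auto simp: \<epsilon>_def)
    obtain C where C: "\<And>x t m. 0 \<le> t \<Longrightarrow> 0 \<le> m \<Longrightarrow>
        \<bar>F x (t + m) - F x t\<bar> \<le> C * F x m + \<epsilon> * F x t"
      using growth[OF \<epsilon>(1)] by blast
    \<comment> \<open>The growth condition concerns nonnegative arguments, while \<open>a\<close>
      and \<open>b\<close> have arbitrary signs. The smaller of |a| and |b - a| plays the role of
      \<open>t\<close>, with m = |b|; the triangle inequality and monotonicity bound the larger one
      by F(t + m).\<close>
    have diff_le: "\<bar>F x \<bar>a\<bar> - F x \<bar>b - a\<bar>\<bar> \<le> C * F x \<bar>b\<bar> + \<epsilon> * F x \<bar>b - a\<bar>" for x a b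
    proof (cases "\<bar>b - a\<bar> \<le> \<bar>a\<bar>")
      case True
      have "F x \<bar>b - a\<bar> \<le> F x \<bar>a\<bar>" "F x \<bar>a\<bar> \<le> F x (\<bar>b - a\<bar> + \<bar>b\<bar>)"
        using True by (auto intro!: F_mono)
      then show ?thesis using C[of "\<bar>b - a\<bar>" "\<bar>b\<bar>" x] by simp
    next
      case False
      have "F x \<bar>a\<bar> \<le> F x \<bar>b - a\<bar>" "F x \<bar>b - a\<bar> \<le> F x (\<bar>a\<bar> + \<bar>b\<bar>)"
        using False by (auto intro!: F_mono)
      moreover from this(1) have "\<epsilon> * F x \<bar>a\<bar> \<le> \<epsilon> * F x \<bar>b - a\<bar>"
        using \<epsilon> by (intro mult_left_mono) auto
      ultimately show ?thesis using C[of "\<bar>a\<bar>" "\<bar>b\<bar>" x] by simp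
    qed
    define G where "G n = (\<lambda>x. max 0 (\<bar>D n x\<bar> - \<epsilon> * F x \<bar>g x - f n x\<bar>))" for n
    have G_le: "G n x \<le> (C + 1) * F x \<bar>g x\<bar>" for n x
    proof -
      have "\<bar>D n x\<bar> \<le> \<bar>F x \<bar>f n x\<bar> - F x \<bar>g x - f n x\<bar>\<bar> + \<bar>F x \<bar>g x\<bar>\<bar>"
        unfolding D_def by (rule abs_triangle_ineq4)
      also have "\<dots> \<le> C * F x \<bar>g x\<bar> + \<epsilon> * F x \<bar>g x - f n x\<bar> + F x \<bar>g x\<bar>"
        using diff_le by (intro add_mono) (simp_all add: F_nonneg)
      finally have "\<bar>D n x\<bar> - \<epsilon> * F x \<bar>g x - f n x\<bar> \<le> (C + 1) * F x \<bar>g x\<bar>"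
        by (simp add: distrib_right)
      \<comment> \<open>No sign of \<open>C\<close> is given; the growth condition at t = 0 yields
        F(|g x|) \<le> C F(|g x|).\<close>
      moreover have "0 \<le> (C + 1) * F x \<bar>g x\<bar>"
        using C[of 0 "\<bar>g x\<bar>" x] F_nonneg[of "\<bar>g x\<bar>" x] by (simp add: algebra_simps)
      ultimately show ?thesis by (simp add: G_def)
    qed
    have G_nonneg: "0 \<le> G n x" for n x by (simp add: G_def)
    have G_meas [measurable]: "G n \<in> borel_measurable M" for n
      unfolding G_def D_def by measurable
    have dom: "AE x in M. norm (G n x) \<le> (C + 1) * F x \<bar>g x\<bar>" for n
      using G_le G_nonneg by (intro AE_I2) simp
    have G_conv: "AE x in M. (\<lambda>n. G n x) \<longlonglongrightarrow> 0"
      using conv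
    proof eventually_elim
      case (elim x)
      have d0: "(\<lambda>n. F x \<bar>g x - f n x\<bar>) \<longlonglongrightarrow> F x \<bar>g x - g x\<bar>"
        by (intro tendsto_F tendsto_intros elim) auto
      moreover have "(\<lambda>n. F x \<bar>f n x\<bar>) \<longlonglongrightarrow> F x \<bar>g x\<bar>"
        by (intro tendsto_F tendsto_intros elim) auto
      ultimately have "(\<lambda>n. G n x) \<longlonglongrightarrow> max 0 (\<bar>F x \<bar>g x\<bar> - F x \<bar>g x - g x\<bar> - F x \<bar>g x\<bar>\<bar>
          - \<epsilon> * F x \<bar>g x - g x\<bar>)"
        unfolding G_def D_def by (intro tendsto_intros)
      then show ?case by simp
    qed
    have w_int: "integrable M (\<lambda>x. (C + 1) * F x \<bar>g x\<bar>)" by simp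
    have "(\<lambda>n. LINT x|M. G n x) \<longlonglongrightarrow> (LINT x|M. 0)"
      by (rule integral_dominated_convergence[OF _ G_meas w_int G_conv dom]) simp
    moreover have G_int: "integrable M (G n)" for n
      by (rule integrable_dominated_convergence2[OF _ G_meas w_int G_conv dom]) simp
    ultimately obtain N where N: "\<And>n. N \<le> n \<Longrightarrow> \<bar>LINT x|M. G n x\<bar> < r / 2"
      using LIMSEQ_D[of "\<lambda>n. LINT x|M. G n x" 0 "r / 2"] r by auto
    show "\<exists>N. \<forall>n\<ge>N. norm ((LINT x|M. \<bar>D n x\<bar>) - 0) < r"
    proof (intro exI[of _ N] allI impI)
      fix n assume n: "N \<le> n"
      have "(LINT x|M. \<bar>D n x\<bar>) \<le> (LINT x|M. G n x + \<epsilon> * F x \<bar>g x - f n x\<bar>)"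
        by (intro integral_mono) (auto simp: G_int G_def)
      also have "\<dots> = (LINT x|M. G n x) + \<epsilon> * rho (\<lambda>x. g x - f n x)"
        by (simp add: G_int rho_def)
      also have "\<dots> \<le> (LINT x|M. G n x) + \<epsilon> * R'"
        using rho_d \<epsilon> by (intro add_left_mono mult_left_mono) auto
      also have "\<dots> < r" using N[OF n] \<epsilon>(2) by simp
      finally show "norm ((LINT x|M. \<bar>D n x\<bar>) - 0) < r" by simp
    qed
  qed
  have "(\<lambda>n. LINT x|M. D n x * h x) \<longlonglongrightarrow> 0"
  proof (rule Lim_null_comparison)
    show "\<forall>\<^sub>F n in sequentially. norm (LINT x|M. D n x * h x) \<le> B * (LINT x|M. \<bar>D n x\<bar>)"
    proof (rule always_eventually, rule allI)
      fix n
      have "norm (LINT x|M. D n x * h x) \<le> (LINT x|M. norm (D n x * h x))"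
        by (rule integral_norm_bound)
      also have "\<dots> \<le> (LINT x|M. B * \<bar>D n x\<bar>)"
      proof (rule integral_mono_AE)
        show "AE x in M. norm (D n x * h x) \<le> B * \<bar>D n x\<bar>"
          using h_le by eventually_elim (auto simp: abs_mult mult.commute intro!: mult_right_mono)
      qed (intro integrable_norm integrable_mult_right integrable_abs int_h D_int)+
      finally show "norm (LINT x|M. D n x * h x) \<le> B * (LINT x|M. \<bar>D n x\<bar>)" by simp
    qed
    show "(\<lambda>n. B * (LINT x|M. \<bar>D n x\<bar>)) \<longlonglongrightarrow> 0"
      using tendsto_mult_left[OF D_lim, of B] by simp
  qed
  moreover have "(LINT x|M. D n x * h x) = (LINT x|M. F x \<bar>f n x\<bar> * h x)
      - (LINT x|M. F x \<bar>g x - f n x\<bar> * h x) - (LINT x|M. F x \<bar>g x\<bar> * h x)" for n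
    by (simp add: D_def left_diff_distrib)
  ultimately show ?thesis by (subst LIM_zero_iff[symmetric]) simp
qed

end

section \<open>Real-valued versions of \<open>\<Phi>\<close>-functions\<close>

text \<open>The original integrand composed with \<open>u\<close> is only almost everywhere equal to
  its real-valued version; completeness transfers measurability from the latter.\<close>

lemma (in complete_measure) borel_measurable_AE_cong:
  fixes f g :: "'a \<Rightarrow> 'b::topological_space"
  assumes f: "f \<in> borel_measurable M" and eq: "AE x in M. f x = g x"
  shows "g \<in> borel_measurable M"
proof (rule measurableI)
  fix A :: "'b set" assume A: "A \<in> sets borel"
  show "g -` A \<inter> space M \<in> sets M"
  proof (rule in_sets_AE)
    show "AE x in M. x \<in> f -` A \<inter> space M \<longleftrightarrow> x \<in> g -` A \<inter> space M"
      using eq by eventually_elim auto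
  qed (use measurable_sets[OF f A] in auto)
qed simp

lemma complete_measure_lebesgue_on:
  assumes "S \<in> sets lebesgue"
  shows "complete_measure (lebesgue_on S)"
proof
  fix A B assume "B \<subseteq> A" "A \<in> null_sets (lebesgue_on S)"
  then have "B \<subseteq> S" "B \<in> sets lebesgue"
    using assms completion.complete[of B A lborel] by (auto simp: null_sets_restrict_space)
  then show "B \<in> sets (lebesgue_on S)"
    using assms by (simp add: sets_restrict_space_iff)
qed

text \<open>The growth condition holds almost everywhere only for each fixed pair \<open>(t, m)\<close>, hence almost
  everywhere for all pairs in a countable set; continuity extends it to all real arguments.\<close>
locale regular_Phi =
  fixes \<psi> :: "real \<Rightarrow> ennreal" and C :: "nat \<Rightarrow> real"
  assumes mono: "mono_on {0..} \<psi>"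
    and convex: "\<forall>s\<ge>0. \<forall>t\<ge>0. \<forall>u\<ge>0. \<forall>v\<ge>0. u + v = 1 \<longrightarrow>
           \<psi> (u * s + v * t) \<le> ennreal u * \<psi> s + ennreal v * \<psi> t"
    and continuous: "continuous_on {0..} \<psi>"
    and zero: "\<psi> 0 = 0"
    and at_0: "(\<psi> \<longlongrightarrow> 0) (at_right 0)"
    and C_pos: "0 < C j"
    and growth: "\<bar>enn2ereal (\<psi> (real i / real (Suc n) + real k / real (Suc n)))
          - enn2ereal (\<psi> (real i / real (Suc n)))\<bar>
        \<le> ereal (C j) * enn2ereal (\<psi> (real k / real (Suc n)))
          + ereal (1 / real (Suc j)) * enn2ereal (\<psi> (real i / real (Suc n)))"
begin

text \<open>Values near 0 are below 1. The growth inequality with both arguments equal preserves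
  finiteness under doubling, since an infinite value at the doubled point would make its left side
  infinite and leave the right side finite. Monotonicity then covers every \<open>t\<close>.\<close>

lemma finite:
  assumes "0 \<le> t"
  shows "\<psi> t < \<infinity>"
proof -
  have "\<forall>\<^sub>F s in at_right 0. \<psi> s < 1"
    using at_0 by (rule order_tendstoD) simp
  then obtain b where b: "0 < b" "\<And>s. 0 < s \<Longrightarrow> s < b \<Longrightarrow> \<psi> s < 1"
    by (auto simp: eventually_at_right_field)
  obtain n where n: "1 / real (Suc n) < b"
    using reals_Archimedean[OF b(1)] by (auto simp: inverse_eq_divide)
  have fin: "\<psi> (real (2 ^ p) / real (Suc n)) < \<infinity>" for p
  proof (induction p)
    case 0
    show ?case using b(2)[OF _ n] by (auto intro: less_trans)
  next
    case (Suc p)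
    obtain r where r: "0 \<le> r" "\<psi> (real (2 ^ p) / real (Suc n)) = ennreal r"
      using Suc by (cases "\<psi> (real (2 ^ p) / real (Suc n))") auto
    have "real (2 ^ p) / real (Suc n) + real (2 ^ p) / real (Suc n) = real (2 ^ Suc p) / real (Suc n)"
      by (simp flip: add_divide_distrib)
    then have "\<bar>enn2ereal (\<psi> (real (2 ^ Suc p) / real (Suc n))) - ereal r\<bar>
        \<le> ereal (C 0) * ereal r + ereal (1 / real (Suc 0)) * ereal r"
      using growth[of "2 ^ p" n "2 ^ p" 0] r by (simp only: enn2ereal_ennreal)
    then show ?case
      by (cases "\<psi> (real (2 ^ Suc p) / real (Suc n))") (auto simp: less_top)
  qed
  obtain p :: nat where "t * real (Suc n) < 2 ^ p"
    using real_arch_pow[of 2 "t * real (Suc n)"] by auto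
  then have "t \<le> real (2 ^ p) / real (Suc n)" by (simp add: field_simps)
  then have "\<psi> t \<le> \<psi> (real (2 ^ p) / real (Suc n))"
    using assms by (intro mono_onD[OF mono]) auto
  then show ?thesis using fin by (rule le_less_trans)
qed

lemma eq_ennreal: "0 \<le> t \<Longrightarrow> \<psi> t = ennreal (enn2real (\<psi> t))"
  using finite by simp

lemma real_mono: "mono_on {0..} (\<lambda>t. enn2real (\<psi> t))"
  using mono_onD[OF mono] finite by (intro mono_onI enn2real_mono) auto

lemma real_convex: "convex_on {0..} (\<lambda>t. enn2real (\<psi> t))"
proof (rule convex_onI)
  fix u s t :: real assume *: "0 < u" "u < 1" "s \<in> {0..}" "t \<in> {0..}"
  have "\<psi> ((1 - u) * s + u * t) \<le> ennreal (1 - u) * \<psi> s + ennreal u * \<psi> t"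
    using * convex by simp
  also have "\<dots> = ennreal (1 - u) * ennreal (enn2real (\<psi> s)) + ennreal u * ennreal (enn2real (\<psi> t))"
    using * eq_ennreal by simp
  also have "\<dots> = ennreal ((1 - u) * enn2real (\<psi> s) + u * enn2real (\<psi> t))"
    using * by (simp add: ennreal_mult ennreal_plus)
  finally show "enn2real (\<psi> ((1 - u) *\<^sub>R s + u *\<^sub>R t))
      \<le> (1 - u) * enn2real (\<psi> s) + u * enn2real (\<psi> t)"
    using * by (intro enn2real_leI) auto
qed (rule convex_real_interval)

lemma real_continuous: "continuous_on {0..} (\<lambda>t. enn2real (\<psi> t))"
  unfolding continuous_on_def
proof
  fix t :: real assume t: "t \<in> {0..}"
  then have "(\<psi> \<longlongrightarrow> ennreal (enn2real (\<psi> t))) (at t within {0..})"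
    using continuous eq_ennreal by (simp add: continuous_on_def)
  then show "((\<lambda>t. enn2real (\<psi> t)) \<longlongrightarrow> enn2real (\<psi> t)) (at t within {0..})"
    by (rule tendsto_enn2real) simp
qed

text \<open>Rounding \<open>t\<close> and \<open>m\<close> with the same denominator gives an
  instance of the assumed inequality, and both sides converge by continuity.\<close>

lemma real_growth:
  assumes t: "0 \<le> t" and m: "0 \<le> m"
  shows "\<bar>enn2real (\<psi> (t + m)) - enn2real (\<psi> t)\<bar>
    \<le> C j * enn2real (\<psi> m) + 1 / real (Suc j) * enn2real (\<psi> t)"
proof -
  let ?G = "\<lambda>t. enn2real (\<psi> t)"
  have "\<bar>?G (grid n t + grid n m) - ?G (grid n t)\<bar>
      \<le> C j * ?G (grid n m) + 1 / real (Suc j) * ?G (grid n t)" for n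
  proof -
    have e: "enn2ereal (\<psi> s) = ereal (?G s)" if "0 \<le> s" for s
      by (subst eq_ennreal[OF that]) (rule enn2ereal_ennreal, simp)
    have "\<bar>enn2ereal (\<psi> (grid n t + grid n m)) - enn2ereal (\<psi> (grid n t))\<bar>
        \<le> ereal (C j) * enn2ereal (\<psi> (grid n m)) + ereal (1 / real (Suc j)) * enn2ereal (\<psi> (grid n t))"
      unfolding grid_def by (rule growth)
    then show ?thesis
      by (simp only: e grid_nonneg add_nonneg_nonneg) simp
  qed
  moreover have lim: "(\<lambda>n. ?G (u n)) \<longlonglongrightarrow> ?G s" if "u \<longlonglongrightarrow> s" "\<And>n. 0 \<le> u n" "0 \<le> s" for u s
    using that by (intro continuous_on_tendsto_compose[OF real_continuous]) auto
  have "(\<lambda>n. \<bar>?G (grid n t + grid n m) - ?G (grid n t)\<bar>) \<longlonglongrightarrow> \<bar>?G (t + m) - ?G t\<bar>"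
    by (intro tendsto_intros lim tendsto_grid add_nonneg_nonneg grid_nonneg t m)
  moreover have "(\<lambda>n. C j * ?G (grid n m) + 1 / real (Suc j) * ?G (grid n t))
      \<longlonglongrightarrow> C j * ?G m + 1 / real (Suc j) * ?G t"
    by (intro tendsto_add tendsto_mult tendsto_const lim tendsto_grid grid_nonneg t m)
  ultimately show ?thesis by (intro LIMSEQ_le) auto
qed

end

lemma ex_doubling_version:
  assumes Phi: "gen_strong_Phi M \<phi>"
    and growth: "\<forall>\<epsilon>>0. \<exists>C>0. \<forall>t\<ge>0. \<forall>m\<ge>0. AE x in M.
      \<bar>enn2ereal (\<phi> x \<bar>t + m\<bar>) - enn2ereal (\<phi> x \<bar>t\<bar>)\<bar>
        \<le> ereal C * enn2ereal (\<phi> x \<bar>m\<bar>) + ereal \<epsilon> * enn2ereal (\<phi> x \<bar>t\<bar>)"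
  obtains F K where "doubling_Phi M F K"
    and "\<And>\<epsilon>. 0 < \<epsilon> \<Longrightarrow> \<exists>C. \<forall>x. \<forall>t\<ge>0. \<forall>m\<ge>0. \<bar>F x (t + m) - F x t\<bar> \<le> C * F x m + \<epsilon> * F x t"
    and "AE x in M. \<forall>t\<ge>0. \<phi> x t = ennreal (F x t)"
proof -
  \<comment> \<open>Restricting \<epsilon> to the values 1/(j+1) leaves countably many inequalities,
    whose exceptional sets unite to one null set.\<close>
  have "\<forall>j. \<exists>C>0. \<forall>t\<ge>0. \<forall>m\<ge>0. AE x in M.
      \<bar>enn2ereal (\<phi> x \<bar>t + m\<bar>) - enn2ereal (\<phi> x \<bar>t\<bar>)\<bar>
        \<le> ereal C * enn2ereal (\<phi> x \<bar>m\<bar>) + ereal (1 / real (Suc j)) * enn2ereal (\<phi> x \<bar>t\<bar>)"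
    using growth by simp
  from choice[OF this] obtain C where C_pos: "\<And>j. 0 < C j"
    and C: "\<And>j t m. 0 \<le> t \<Longrightarrow> 0 \<le> m \<Longrightarrow> AE x in M.
      \<bar>enn2ereal (\<phi> x \<bar>t + m\<bar>) - enn2ereal (\<phi> x \<bar>t\<bar>)\<bar>
        \<le> ereal (C j) * enn2ereal (\<phi> x \<bar>m\<bar>) + ereal (1 / real (Suc j)) * enn2ereal (\<phi> x \<bar>t\<bar>)"
    by blast
  have "AE x in M. \<forall>j i n k. \<bar>enn2ereal (\<phi> x (real i / real (Suc n) + real k / real (Suc n)))
          - enn2ereal (\<phi> x (real i / real (Suc n)))\<bar>
        \<le> ereal (C j) * enn2ereal (\<phi> x (real k / real (Suc n)))
          + ereal (1 / real (Suc j)) * enn2ereal (\<phi> x (real i / real (Suc n)))"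
    unfolding AE_all_countable
  proof (intro allI)
    fix j i n k :: nat
    have "0 \<le> real i / real (Suc n)" "0 \<le> real k / real (Suc n)" by auto
    from C[OF this, of j] this
    show "AE x in M. \<bar>enn2ereal (\<phi> x (real i / real (Suc n) + real k / real (Suc n)))
          - enn2ereal (\<phi> x (real i / real (Suc n)))\<bar>
        \<le> ereal (C j) * enn2ereal (\<phi> x (real k / real (Suc n)))
          + ereal (1 / real (Suc j)) * enn2ereal (\<phi> x (real i / real (Suc n)))"
      by (simp only: abs_of_nonneg add_nonneg_nonneg)
  qed
  then have "AE x in M. regular_Phi (\<phi> x) C"
    using conjunct2[OF Phi[unfolded gen_strong_Phi_def]]
    by eventually_elim (simp add: regular_Phi_def C_pos)
  then obtain Z where Z: "Z \<in> null_sets M" and reg_Z: "{x \<in> space M. \<not> regular_Phi (\<phi> x) C} \<subseteq> Z"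
    by (auto simp: eventually_ae_filter)
  then have reg: "regular_Phi (\<phi> x) C" if "x \<in> space M - Z" for x using that by auto
  \<comment> \<open>On the exceptional null set, \<open>F\<close> is \<open>0\<close> so that the properties hold for every \<open>x\<close>.\<close>
  define F where "F x t = (if x \<in> space M - Z then enn2real (\<phi> x t) else 0)" for x t
  have F_eq: "F x = (\<lambda>t. enn2real (\<phi> x t)) \<and> x \<in> space M - Z \<or> F x = (\<lambda>t. 0)" for x
    by (cases "x \<in> space M - Z") (auto simp: F_def)
  have F_growth: "\<bar>F x (t + m) - F x t\<bar> \<le> C j * F x m + 1 / real (Suc j) * F x t"
    if "0 \<le> t" "0 \<le> m" for x t m j
    using F_eq[of x] regular_Phi.real_growth[OF reg that, of x j] by auto
  show thesis
  proof (rule that)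
    \<comment> \<open>The case t = m, \<epsilon> = 1 of the growth condition reads F(2t) - F(t)
      \<le> C 0 F(t) + F(t), whence the constant.\<close>
    show "doubling_Phi M F (C 0 + 2)"
    proof
      show "(\<lambda>x. F x t) \<in> borel_measurable M" if "0 \<le> t" for t
      proof -
        have [measurable]: "(\<lambda>x. \<phi> x t) \<in> borel_measurable M" "space M - Z \<in> sets M"
          using Phi Z that by (auto simp: gen_strong_Phi_def)
        show ?thesis unfolding F_def by measurable
      qed
      show "convex_on {0..} (F x)" for x
        using F_eq[of x] regular_Phi.real_convex[OF reg, of x] by (auto simp: convex_on_def)
      show "continuous_on {0..} (F x)" for x
        using F_eq[of x] regular_Phi.real_continuous[OF reg, of x] by auto
      show "mono_on {0..} (F x)" for x
        using F_eq[of x] regular_Phi.real_mono[OF reg, of x] by (auto simp: mono_on_def)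
      show "F x 0 = 0" for x
        using F_eq[of x] regular_Phi.zero[OF reg, of x] by auto
      show "F x (2 * t) \<le> (C 0 + 2) * F x t" if "0 \<le> t" for x t
        using F_growth[OF that that, of x 0] by (simp add: algebra_simps)
      show "1 \<le> C 0 + 2" using C_pos[of 0] by simp
    qed
    show "\<exists>C. \<forall>x. \<forall>t\<ge>0. \<forall>m\<ge>0. \<bar>F x (t + m) - F x t\<bar> \<le> C * F x m + \<epsilon> * F x t"
      if \<epsilon>: "0 < \<epsilon>" for \<epsilon> :: real
    proof -
      obtain j where j: "1 / real (Suc j) < \<epsilon>"
        using reals_Archimedean[OF \<epsilon>] by (auto simp: inverse_eq_divide)
      have "1 / real (Suc j) * F x t \<le> \<epsilon> * F x t" for x t
        using j by (intro mult_right_mono) (auto simp: F_def)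
      with F_growth[of _ _ _ j] show ?thesis
        by (intro exI[of _ "C j"]) (meson add_left_mono order_trans)
    qed
    show "AE x in M. \<forall>t\<ge>0. \<phi> x t = ennreal (F x t)"
      using AE_not_in[OF Z] AE_space
    proof eventually_elim
      case (elim x)
      then show ?case using regular_Phi.eq_ennreal[OF reg, of x] by (auto simp: F_def)
    qed
  qed
qed

section \<open>Weak convergence and the Brezis-Lieb lemma\<close>

context doubling_Phi
begin

context
  fixes \<phi> :: "'a \<Rightarrow> real \<Rightarrow> ennreal"
  assumes eq: "AE x in M. \<forall>t\<ge>0. \<phi> x t = ennreal (F x t)"
begin

lemma modular_eq_nn_integral: "modular M \<phi> u = (\<integral>\<^sup>+x. ennreal (F x \<bar>u x\<bar>) \<partial>M)"
  unfolding modular_def using eq by (intro nn_integral_cong_AE) auto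

lemma modular_eq_rho: "u \<in> orlicz \<Longrightarrow> modular M \<phi> u = ennreal (rho u)"
  unfolding modular_eq_nn_integral rho_def
  by (intro nn_integral_eq_integral orlicz_integrable AE_I2 F_nonneg) auto

text \<open>Doubling removes the scaling factor: if \<open>k * u\<close> has finite modular, so does
  its multiple by 1/k.\<close>

lemma L_Phi_eq_orlicz: "L_Phi M \<phi> = orlicz"
proof (intro equalityI subsetI)
  fix u assume "u \<in> L_Phi M \<phi>"
  then obtain k where [measurable]: "u \<in> borel_measurable M"
    and k: "0 < k" "modular M \<phi> (\<lambda>x. k * u x) < \<infinity>"
    by (auto simp: L_Phi_def)
  have "integrable M (\<lambda>x. F x \<bar>k * u x\<bar>)"
    using k(2) unfolding modular_eq_nn_integral by (intro integrableI_nonneg) (auto simp: F_nonneg)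
  then have "(\<lambda>x. k * u x) \<in> orlicz" by (simp add: orlicz_def)
  from orlicz_scale[OF this, of "1 / k"] k(1) show "u \<in> orlicz" by simp
next
  fix u assume "u \<in> orlicz"
  then show "u \<in> L_Phi M \<phi>"
    using modular_eq_rho[of u] by (auto simp: L_Phi_def orlicz_measurable intro!: exI[of _ 1])
qed

text \<open>A functional bounded where \<open>rho\<close> is at most 1 is bounded by the Luxemburg
  seminorm, hence lies in the dual. Weak convergence makes its values along \<open>f n\<close>
  converge, which contradicts their unboundedness.\<close>

lemma weakly_converges_Bseq_rho:
  assumes weak: "weakly_converges M \<phi> f g"
  shows "Bseq (\<lambda>n. rho (f n))"
proof (rule ccontr)
  assume "\<not> Bseq (\<lambda>n. rho (f n))"
  moreover have "\<And>n. f n \<in> orlicz"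
    using weak by (simp add: weakly_converges_def L_Phi_eq_orlicz)
  ultimately obtain T C
    where add: "\<And>u v. u \<in> orlicz \<Longrightarrow> v \<in> orlicz \<Longrightarrow> T (\<lambda>x. u x + v x) = T u + T v"
      and scale: "\<And>c u. u \<in> orlicz \<Longrightarrow> T (\<lambda>x. c * u x) = c * T u"
      and C: "\<And>u. u \<in> orlicz \<Longrightarrow> rho u \<le> 1 \<Longrightarrow> \<bar>T u\<bar> \<le> C"
      and T: "\<not> Bseq (\<lambda>n. T (f n))"
    using ex_unbounded_functional by blast
  \<comment> \<open>The maximum with 1 makes the constant positive, so that it can be divided out
    before taking the infimum.\<close>
  have "\<bar>T u\<bar> \<le> max C 1 * lux_norm M \<phi> u" if u: "u \<in> orlicz" for u
  proof -
    have "\<bar>T u\<bar> / max C 1 \<le> lux_norm M \<phi> u"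
      unfolding lux_norm_def
    proof (rule cInf_greatest)
      \<comment> \<open>The infimum has to be over a nonempty set; normalization by a power of 2
        supplies an element.\<close>
      obtain j where "rho (\<lambda>x. u x / 2 ^ j) \<le> 1" using ex_normalization[OF u] by blast
      moreover have "(\<lambda>x. u x / 2 ^ j) \<in> orlicz"
        using orlicz_scale[OF u, of "1 / 2 ^ j"] by simp
      ultimately have "2 ^ j \<in> {k. 0 < k \<and> modular M \<phi> (\<lambda>x. u x / k) \<le> 1}"
        by (simp add: modular_eq_rho ennreal_le_1)
      then show "{k. 0 < k \<and> modular M \<phi> (\<lambda>x. u x / k) \<le> 1} \<noteq> {}" by blast
    next
      fix k assume "k \<in> {k. 0 < k \<and> modular M \<phi> (\<lambda>x. u x / k) \<le> 1}"
      then have k: "0 < k" "modular M \<phi> (\<lambda>x. u x / k) \<le> 1" by auto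
      have v: "(\<lambda>x. u x / k) \<in> orlicz" using orlicz_scale[OF u, of "1 / k"] by simp
      have "\<bar>T (\<lambda>x. u x / k)\<bar> \<le> C"
        using k(2) by (intro C v) (simp add: modular_eq_rho[OF v] ennreal_le_1)
      moreover have "T (\<lambda>x. u x / k) = T u / k" using scale[OF u, of "1 / k"] by simp
      ultimately have "\<bar>T u\<bar> \<le> C * k" using k(1) by (simp add: field_simps)
      also have "\<dots> \<le> max C 1 * k" using k(1) by (intro mult_right_mono) auto
      finally show "\<bar>T u\<bar> / max C 1 \<le> k" by (simp add: divide_le_eq mult.commute)
    qed
    then show ?thesis by (simp add: pos_divide_le_eq mult.commute)
  qed
  then have "T \<in> dual_L_Phi M \<phi>"
    unfolding dual_L_Phi_def L_Phi_eq_orlicz using add scale by blast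
  then have "(\<lambda>n. T (f n)) \<longlonglongrightarrow> T g"
    using weak by (simp add: weakly_converges_def)
  then have "Bseq (\<lambda>n. T (f n))" by (intro convergent_imp_Bseq convergentI)
  with T show False by blast
qed

lemma Phi_integrable_and_integral:
  assumes "complete_measure M" and u: "u \<in> orlicz" and h: "h \<in> L_infty M"
  shows "Phi_integrable M \<phi> u h"
    and "(LINT x|M. enn2real (\<phi> x \<bar>u x\<bar>) * h x) = (LINT x|M. F x \<bar>u x\<bar> * h x)"
proof -
  have h_meas: "h \<in> borel_measurable M" using h by (simp add: L_infty_def)
  obtain B where B: "AE x in M. \<bar>h x\<bar> \<le> B" using h by (auto simp: L_infty_def)
  have int: "integrable M (\<lambda>x. F x \<bar>u x\<bar> * h x)"
    using orlicz_integrable[OF u] h_meas B by (rule integrable_mult_bounded)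
  have ae: "AE x in M. F x \<bar>u x\<bar> * h x = enn2real (\<phi> x \<bar>u x\<bar>) * h x"
    using eq by eventually_elim (simp add: F_nonneg)
  have meas: "(\<lambda>x. enn2real (\<phi> x \<bar>u x\<bar>) * h x) \<in> borel_measurable M"
    using complete_measure.borel_measurable_AE_cong[OF assms(1) borel_measurable_integrable[OF int] ae] .
  have "AE x in M. \<phi> x \<bar>u x\<bar> < \<infinity>"
    using eq by eventually_elim simp
  then show "Phi_integrable M \<phi> u h"
    using integrable_cong_AE_imp[OF int meas ae] by (simp add: Phi_integrable_def)
  show "(LINT x|M. enn2real (\<phi> x \<bar>u x\<bar>) * h x) = (LINT x|M. F x \<bar>u x\<bar> * h x)"
    by (intro integral_cong_AE meas borel_measurable_integrable[OF int] AE_symmetric[OF ae])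
qed

end

end

theorem lemma4p3:
  fixes \<Omega> :: "(real ^ 'n) set"
    and \<N> :: "real ^ 'n \<Rightarrow> real \<Rightarrow> ennreal"
    and f :: "nat \<Rightarrow> real ^ 'n \<Rightarrow> real"
    and g :: "real ^ 'n \<Rightarrow> real"
    and \<phi> :: "real ^ 'n \<Rightarrow> real"
  assumes dim: "CARD('n) \<ge> 2"
    and domain: "bounded_lipschitz_domain \<Omega>"
    and Phi: "gen_strong_Phi (lebesgue_on \<Omega>) \<N>"
    and growth: "\<forall>\<epsilon>>0. \<exists>C>0. \<forall>t\<ge>0. \<forall>m\<ge>0. AE x in lebesgue_on \<Omega>.
      \<bar>enn2ereal (\<N> x \<bar>t + m\<bar>) - enn2ereal (\<N> x \<bar>t\<bar>)\<bar>
        \<le> ereal C * enn2ereal (\<N> x \<bar>m\<bar>) + ereal \<epsilon> * enn2ereal (\<N> x \<bar>t\<bar>)"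
    and ae: "AE x in lebesgue_on \<Omega>. (\<lambda>n. f n x) \<longlonglongrightarrow> g x"
    and weak: "weakly_converges (lebesgue_on \<Omega>) \<N> f g"
    and phi: "\<phi> \<in> L_infty (lebesgue_on \<Omega>)"
  shows "(\<forall>n. Phi_integrable (lebesgue_on \<Omega>) \<N> (f n) \<phi>) \<and>
    (\<forall>n. Phi_integrable (lebesgue_on \<Omega>) \<N> (\<lambda>x. g x - f n x) \<phi>) \<and>
    Phi_integrable (lebesgue_on \<Omega>) \<N> g \<phi> \<and>
    (\<lambda>n. (LINT x|lebesgue_on \<Omega>. enn2real (\<N> x \<bar>f n x\<bar>) * \<phi> x)
        - (LINT x|lebesgue_on \<Omega>. enn2real (\<N> x \<bar>g x - f n x\<bar>) * \<phi> x))
      \<longlonglongrightarrow> (LINT x|lebesgue_on \<Omega>. enn2real (\<N> x \<bar>g x\<bar>) * \<phi> x)"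
proof -
  let ?M = "lebesgue_on \<Omega>"
  have "\<Omega> \<in> sets lebesgue"
    using domain by (simp add: bounded_lipschitz_domain_def)
  then have complete: "complete_measure ?M" by (rule complete_measure_lebesgue_on)
  obtain F K where "doubling_Phi ?M F K"
    and F_growth: "\<And>\<epsilon>. 0 < \<epsilon> \<Longrightarrow>
      \<exists>C. \<forall>x. \<forall>t\<ge>0. \<forall>m\<ge>0. \<bar>F x (t + m) - F x t\<bar> \<le> C * F x m + \<epsilon> * F x t"
    and eq: "AE x in ?M. \<forall>t\<ge>0. \<N> x t = ennreal (F x t)"
    using ex_doubling_version[OF Phi growth] by blast
  then interpret doubling_Phi ?M F K by simp
  have f: "\<And>n. f n \<in> orlicz" and g: "g \<in> orlicz"
    using weak by (simp_all add: weakly_converges_def L_Phi_eq_orlicz[OF eq])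
  have d: "(\<lambda>x. g x - f n x) \<in> orlicz" for n by (intro orlicz_diff f g)
  obtain B where B: "AE x in ?M. \<bar>\<phi> x\<bar> \<le> B" and phi_meas: "\<phi> \<in> borel_measurable ?M"
    using phi by (auto simp: L_infty_def)
  \<comment> \<open>All integrals of \<open>\<N>\<close> become integrals of its real-valued version
    \<open>F\<close>, for which the limit is already known.\<close>
  note int = Phi_integrable_and_integral[OF eq complete _ phi]
  show ?thesis
    unfolding int(2)[OF f] int(2)[OF g] int(2)[OF d]
    using Brezis_Lieb[OF F_growth f g ae weakly_converges_Bseq_rho[OF eq weak] phi_meas B]
      int(1)[OF f] int(1)[OF g] int(1)[OF d] by blast
qed

end
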